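(* Let $p,N\in\mathbb{N}$ with $p<N$ and let $S\in\mathrm{O}(N)$. Then the following hold. (a) $\mathrm{St}(p,N)\setminus E_{N,p}(S)=\Xi(\mathrm{O}(N)\setminus E_{N,N}(S))$, i.e., $\Phi_S^{-1}(Q_{N,p})=\Xi\circ\varphi_S^{-1}(Q_{N,p})=\Xi\circ\varphi_S^{-1}(Q_{N,N})$, where $\Xi:\mathrm{O}(N)\to\mathrm{St}(p,N):U\mapsto UI_{N\times p}$. (b) $\mathrm{St}(p,N)\setminus E_{N,p}(S)$ is an open dense subset of $\mathrm{St}(p,N)$. (c) For $S_1,S_2\in\mathrm{O}(N)$, the subset $\Delta(S_1,S_2):=(\mathrm{St}(p,N)\setminus E_{N,p}(S_1))\cap(\mathrm{St}(p,N)\setminus E_{N,p}(S_2))$ is a nonempty open dense subset of $\mathrm{St}(p,N)$. (d) Let $g:Q_{N,p}(S)\to\mathbb{R}:V\mapsto\det(I_p+S_{\rm le}^T\Phi_S^{-1}(V))$. Then $g$ is a positive-valued function and $\displaystyle\lim_{V\in Q_{N,p}(S),\ \|V\|_2\to\infty}g(V)=0$. Conversely, if a sequence $(V_n)_{n=0}^\infty\subset Q_{N,p}(S)$ satisfies $\lim_{n\to\infty}g(V_n)=0$, then $\lim_{n\to\infty}\|V_n\|_2=\infty$.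
   Context: Notation: $\mathrm{St}(p,N)=\{U\in\mathbb{R}^{N\times p}\mid U^TU=I_p\}$ with the subspace topology from $\mathbb{R}^{N\times p}$, $\mathrm{O}(N)=\mathrm{St}(N,N)$. $I$ is the $N\times N$ identity, $I_{N\times p}$ is the matrix of the first $p$ columns of $I$. For $S\in\mathbb{R}^{N\times N}$, $S_{\rm le}\in\mathbb{R}^{N\times p}$ is the block of the first $p$ columns. $\|\cdot\|_2$ is the spectral norm. $Q_{N,N}=\{V\in\mathbb{R}^{N\times N}\mid V^T=-V\}$, and $$Q_{N,p}(S):=Q_{N,p}:=\left\{\begin{bmatrix}A&-B^T\\ B&0\end{bmatrix}\ \middle|\ A\in\mathbb{R}^{p\times p},\ A^T=-A,\ B\in\mathbb{R}^{(N-p)\times p}\right\}\subset Q_{N,N}.$$ $E_{N,p}(S):=\{U\in\mathrm{St}(p,N)\mid\det(I_p+S_{\rm le}^TU)=0\}$ and $E_{N,N}(S)=\{U\in\mathrm{O}(N)\mid \det(I+S^TU)=0\}$. $\varphi_S^{-1}:Q_{N,N}\to\mathrm{O}(N)\setminus E_{N,N}(S):V\mapsto S(I-V)(I+V)^{-1}$ is the (bijective) inverse of the left-localized Cayley transform $\varphi_S:U\mapsto (I-S^TU)(I+S^TU)^{-1}$. $\Phi_S^{-1}:Q_{N,p}(S)\to\mathrm{St}(p,N)\setminus E_{N,p}(S):V\mapsto S(I-V)(I+V)^{-1}I_{N\times p}$ is the (bijective) inverse of the generalized left-localized Cayley transform $\Phi_S$ centered at $S$. *)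

theory Defs
  imports "HOL-Analysis.Analysis"
begin

text \<open>
  Dimensions are types: \<open>p = CARD('p)\<close> and \<open>N = CARD('p + 'm)\<close>, where \<open>'m\<close> indexes the
  remaining \<open>N - p \<ge> 1\<close> coordinates, so \<open>1 \<le> p < N\<close> holds by construction and every such pair
  \<open>(p, N)\<close> arises. The first \<open>p\<close> coordinates are the indices of the form \<open>Inl j\<close>.
  As usual in the library, an \<open>N \<times> p\<close> matrix has type \<open>real ^ 'p ^ ('p + 'm)\<close>,
  and \<open>M $ i $ j\<close> is the entry in row \<open>i\<close> and column \<open>j\<close>.
\<close>

definition stiefel :: "(real ^ 'p::finite ^ 'n::finite) set" where
  "stiefel = {U. transpose U ** U = mat 1}"

abbreviation orthogonal_group :: "(real ^ 'n::finite ^ 'n) set" where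
  "orthogonal_group \<equiv> stiefel"

definition left_block :: "real ^ ('p::finite + 'm::finite) ^ 'n \<Rightarrow> real ^ 'p ^ 'n" where
  "left_block M = (\<chi> i j. M $ i $ Inl j)"

abbreviation I_left :: "real ^ 'p::finite ^ ('p + 'm::finite)" where
  "I_left \<equiv> left_block (mat 1)"

definition block_matrix ::
  "real ^ 'p::finite ^ 'p \<Rightarrow> real ^ 'm::finite ^ 'p \<Rightarrow> real ^ 'p ^ 'm \<Rightarrow> real ^ 'm ^ 'm
    \<Rightarrow> real ^ ('p + 'm) ^ ('p + 'm)" where
  "block_matrix A B C D = (\<chi> i j.
     case i of
       Inl a \<Rightarrow> (case j of Inl b \<Rightarrow> A $ a $ b | Inr b \<Rightarrow> B $ a $ b)
     | Inr a \<Rightarrow> (case j of Inl b \<Rightarrow> C $ a $ b | Inr b \<Rightarrow> D $ a $ b))"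

text \<open>\<open>Q\<^bsub>N,N\<^esub>\<close> and \<open>Q\<^bsub>N,p\<^esub>\<close>; neither depends on the centre \<open>S\<close>.\<close>

definition skew_matrices :: "(real ^ 'n::finite ^ 'n) set" where
  "skew_matrices = {V. transpose V = - V}"

definition cayley_domain :: "(real ^ ('p::finite + 'm::finite) ^ ('p + 'm)) set" where
  "cayley_domain = {block_matrix A (- transpose B) B 0 | A B. transpose A = - A}"

text \<open>The singular-point sets \<open>E\<^bsub>N,N\<^esub>(S)\<close> and \<open>E\<^bsub>N,p\<^esub>(S)\<close>.\<close>

definition singular_orth :: "real ^ 'n::finite ^ 'n \<Rightarrow> (real ^ 'n ^ 'n) set" where
  "singular_orth S = {U \<in> orthogonal_group. det (mat 1 + transpose S ** U) = 0}"

definition singular_stiefel ::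
  "real ^ ('p::finite + 'm::finite) ^ ('p + 'm) \<Rightarrow> (real ^ 'p ^ ('p + 'm)) set" where
  "singular_stiefel S = {U \<in> stiefel. det (mat 1 + transpose (left_block S) ** U) = 0}"

text \<open>
  The inverse Cayley transforms \<open>\<phi>\<^sub>S\<^sup>-\<^sup>1\<close> and \<open>\<Phi>\<^sub>S\<^sup>-\<^sup>1\<close>. They are only meant to be applied to skew-symmetric
  \<open>V\<close>, for which \<open>I + V\<close> is invertible and the value of \<^const>\<open>matrix_inv\<close> is the actual inverse.
\<close>

definition cayley_inv :: "real ^ 'n::finite ^ 'n \<Rightarrow> real ^ 'n ^ 'n \<Rightarrow> real ^ 'n ^ 'n" where
  "cayley_inv S V = S ** (mat 1 - V) ** matrix_inv (mat 1 + V)"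

definition gen_cayley_inv ::
  "real ^ ('p::finite + 'm::finite) ^ ('p + 'm) \<Rightarrow> real ^ ('p + 'm) ^ ('p + 'm) \<Rightarrow> real ^ 'p ^ ('p + 'm)" where
  "gen_cayley_inv S V = S ** (mat 1 - V) ** matrix_inv (mat 1 + V) ** I_left"

definition Xi_map :: "real ^ ('p::finite + 'm::finite) ^ ('p + 'm) \<Rightarrow> real ^ 'p ^ ('p + 'm)" where
  "Xi_map U = U ** I_left"

definition cayley_det ::
  "real ^ ('p::finite + 'm::finite) ^ ('p + 'm) \<Rightarrow> real ^ ('p + 'm) ^ ('p + 'm) \<Rightarrow> real" where
  "cayley_det S V = det (mat 1 + transpose (left_block S) ** gen_cayley_inv S V)"

text \<open>The vector norm on \<open>real ^ 'n\<close> is Euclidean, so the induced operator norm is the spectral norm.\<close>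

definition spectral_norm :: "real ^ 'n::finite ^ 'm::finite \<Rightarrow> real" where
  "spectral_norm M = onorm (\<lambda>x. M *v x)"

definition open_dense_in :: "'a::topological_space set \<Rightarrow> 'a set \<Rightarrow> bool" where
  "open_dense_in X D \<longleftrightarrow>
     openin (top_of_set X) D \<and> top_of_set X closure_of D = topspace (top_of_set X)"

end

theory Submission
  imports Defs
begin

text \<open>
  Write \<open>J\<close> for the matrix of the first \<open>p\<close> columns of the identity and \<open>L = S J\<close> for the left
  block of \<open>S\<close>. The object that carries the whole theorem is the \<open>p \<times> p\<close> matrix
  \<open>H = I + L\<^sup>T U\<close>, whose determinant decides whether \<open>U\<close> is singular.

  Surjectivity of the inverse transforms. If \<open>H\<close> is invertible, then \<open>V \<in> Q\<^bsub>N,p\<^esub>\<close> with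
  \<open>\<Phi>\<^sub>S\<^sup>-\<^sup>1(V) = U\<close> can be written down explicitly (\<open>regular_imp_gen_cayley_inv\<close>). In the other
  direction, if \<open>R\<close> is orthogonal then \<open>\<bar>v + R v\<bar>\<^sup>2 = 2 v \<bullet> (v + R v)\<close>, so a kernel vector of the
  leading block of \<open>I + R\<close> gives a kernel vector of \<open>I + R\<close> itself (\<open>Xi_map_regular\<close>). Hence the
  images of \<open>Q\<^bsub>N,p\<^esub>\<close>, of \<open>Q\<^bsub>N,N\<^esub>\<close> and of the regular orthogonal matrices all coincide with the
  regular part of the Stiefel manifold.

  Density. A unit vector \<open>z\<close> in the kernel of \<open>H\<close> satisfies \<open>U z = - L z\<close>. Since \<open>p < N\<close> there is a
  unit vector \<open>e\<close> orthogonal to the columns of \<open>L\<close>. Rotating by a small angle in the plane of \<open>L z\<close>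
  and \<open>e\<close> changes \<open>H\<close> by a rank-one matrix and removes \<open>z\<close> from the kernel without adding anything
  to it. Induction on the dimension of the kernel shows that every point is a limit of regular ones
  (\<open>regular_stiefel_dense\<close>). Two open dense subsets meet in an open dense subset, and this is
  nonempty because the Stiefel manifold is.

  Behaviour of the determinant. \<open>H\<close> is the identity plus a contraction, and along the segment
  \<open>I + t L\<^sup>T U\<close> the determinant does not vanish, so it is positive at regular points. For
  \<open>U = \<Phi>\<^sub>S\<^sup>-\<^sup>1(V)\<close> the matrix \<open>H\<close> is twice the leading block of \<open>(I + V)\<^sup>-\<^sup>1\<close>
  (\<open>cayley_block_resolvent\<close>). Among matrices of norm at most 2, compactness makes a lower bound on
  \<open>\<bar>det H\<bar>\<close> equivalent to a bound \<open>\<bar>H x\<bar> \<ge> c \<bar>x\<bar>\<close>, and the latter is equivalent to an upper bound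
  on \<open>\<bar>V\<bar>\<close>: from left to right because \<open>V\<close> lies in \<open>Q\<^bsub>N,p\<^esub>\<close>, from right to left by
  \<open>\<bar>(I + V) y\<bar> \<le> (1 + \<bar>V\<bar>) \<bar>y\<bar>\<close>. Both limit statements are this equivalence.
\<close>

section \<open>Matrices with orthonormal columns\<close>

text \<open>
  Products \<open>A\<^sup>T y\<close> stay in this form, so that they can be moved across the inner product.
\<close>

declare transpose_matrix_vector [simp del] vector_transpose_matrix [simp del]

lemma inner_transpose_left:
  fixes A :: "real ^ 'n ^ 'm"
  shows "(transpose A *v x) \<bullet> y = x \<bullet> (A *v y)"
  by (simp add: transpose_matrix_vector dot_lmul_matrix)

lemma inner_transpose_right:
  fixes A :: "real ^ 'n ^ 'm"
  shows "y \<bullet> (transpose A *v x) = (A *v y) \<bullet> x"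
  by (metis inner_commute inner_transpose_left)

lemma matrix_vector_mult_minus: "(- A) *v x = - (A *v (x :: real ^ 'n))"
  using matrix_vector_mult_diff_rdistrib[of 0 A x] by simp

lemma stiefel_cancel:
  assumes "U \<in> stiefel"
  shows "transpose U *v (U *v x) = x"
  using assms by (simp add: stiefel_def matrix_vector_mul_assoc)

lemma stiefel_inner:
  assumes "U \<in> stiefel"
  shows "(U *v x) \<bullet> (U *v y) = x \<bullet> y"
  using assms by (metis inner_transpose_left stiefel_cancel)

lemma stiefel_norm:
  assumes "U \<in> stiefel"
  shows "norm (U *v x) = norm x"
  using assms by (simp add: norm_eq_sqrt_inner stiefel_inner)

lemma stiefel_iff_norm:
  fixes U :: "real ^ 'p ^ 'n"
  shows "U \<in> stiefel \<longleftrightarrow> (\<forall>x. norm (U *v x) = norm x)"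
proof
  assume n: "\<forall>x. norm (U *v x) = norm x"
  have sq: "(U *v x) \<bullet> (U *v x) = x \<bullet> x" for x
    using n by (metis dot_square_norm)
  have "(U *v x) \<bullet> (U *v y) = x \<bullet> y" for x y
    using sq[of "x + y"] sq[of x] sq[of y]
    by (simp add: matrix_vector_right_distrib inner_add_left inner_add_right inner_commute)
  then have "transpose U *v (U *v y) = y" for y
    by (metis inner_transpose_right vector_eq_ldot)
  then show "U \<in> stiefel"
    by (simp add: stiefel_def matrix_eq matrix_vector_mul_assoc)
qed (simp add: stiefel_norm)

lemma stiefel_mult: "A \<in> stiefel \<Longrightarrow> U \<in> stiefel \<Longrightarrow> A ** U \<in> stiefel"
  by (simp add: stiefel_iff_norm matrix_vector_mul_assoc[symmetric])

lemma orthogonal_cancel: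
  fixes S :: "real ^ 'n ^ 'n"
  assumes "S \<in> orthogonal_group"
  shows "S *v (transpose S *v x) = x"
  using assms matrix_left_right_inverse[of S "transpose S"]
  by (simp add: stiefel_def matrix_vector_mul_assoc)

lemma orthogonal_transpose:
  fixes S :: "real ^ 'n ^ 'n"
  assumes "S \<in> orthogonal_group"
  shows "transpose S \<in> orthogonal_group"
  using assms matrix_left_right_inverse[of S "transpose S"] by (simp add: stiefel_def)

lemma det_nonzero_iff_kernel:
  fixes A :: "real ^ 'n ^ 'n"
  shows "det A \<noteq> 0 \<longleftrightarrow> (\<forall>x. A *v x = 0 \<longrightarrow> x = 0)"
  by (metis invertible_det_nz invertible_left_inverse matrix_left_invertible_ker)

lemma matrix_inv_cancel:
  fixes A :: "real ^ 'n ^ 'n"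
  assumes "det A \<noteq> 0"
  shows "A *v (matrix_inv A *v x) = x" "matrix_inv A *v (A *v x) = x"
proof -
  have "\<exists>B. A ** B = mat 1 \<and> B ** A = mat 1"
    using assms by (simp flip: invertible_det_nz add: invertible_def)
  then have "A ** matrix_inv A = mat 1 \<and> matrix_inv A ** A = mat 1"
    unfolding matrix_inv_def by (rule someI_ex)
  then show "A *v (matrix_inv A *v x) = x" "matrix_inv A *v (A *v x) = x"
    by (simp_all add: matrix_vector_mul_assoc)
qed

section \<open>The embedding of the first coordinates\<close>

lemma left_block_eq: "left_block M = M ** I_left"
  by (simp add: left_block_def matrix_matrix_mult_def mat_def vec_eq_iff if_distrib
      cong: if_cong)

lemma I_left_apply:
  fixes x :: "real ^ 'p"
  shows "((I_left :: real ^ 'p ^ ('p::finite + 'm::finite)) *v x) $ Inl a = x $ a"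
    and "((I_left :: real ^ 'p ^ ('p::finite + 'm::finite)) *v x) $ Inr b = 0"
  by (simp_all add: left_block_def matrix_vector_mult_def mat_def if_distrib if_distribR
      cong: if_cong)

lemma transpose_I_left_apply:
  fixes y :: "real ^ ('p::finite + 'm::finite)"
  shows "(transpose I_left *v y) $ a = y $ Inl a"
  by (simp add: transpose_def left_block_def matrix_vector_mult_def mat_def if_distrib if_distribR
      cong: if_cong)

lemma I_left_stiefel: "(I_left :: real ^ 'p ^ ('p::finite + 'm::finite)) \<in> stiefel"
proof -
  have "transpose I_left *v ((I_left :: real ^ 'p ^ ('p + 'm)) *v x) = x" for x :: "real ^ 'p"
    by (simp add: vec_eq_iff transpose_I_left_apply I_left_apply)
  then show ?thesis
    by (simp add: stiefel_def matrix_eq matrix_vector_mul_assoc)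
qed

lemma left_block_stiefel:
  "S \<in> orthogonal_group \<Longrightarrow> left_block S \<in> stiefel"
  by (subst left_block_eq) (simp add: stiefel_mult I_left_stiefel)

section \<open>The Cayley transform of skew-symmetric matrices\<close>

lemma skew_inner_self: "V \<in> skew_matrices \<Longrightarrow> y \<bullet> (V *v y) = 0"
  using inner_transpose_left[of V y y]
  by (simp add: skew_matrices_def matrix_vector_mult_minus inner_commute)

lemma skew_inner: "V \<in> skew_matrices \<Longrightarrow> x \<bullet> (V *v y) = - ((V *v x) \<bullet> y)"
  using inner_transpose_left[of V x y]
  by (simp add: skew_matrices_def matrix_vector_mult_minus)

lemma skew_shift_inner:
  "V \<in> skew_matrices \<Longrightarrow> y \<bullet> ((mat 1 + V) *v y) = (norm y)\<^sup>2"
  by (simp add: matrix_vector_mult_add_rdistrib inner_add_right skew_inner_self power2_norm_eq_inner)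

text \<open>
  Both sides are \<open>\<bar>y\<bar>\<^sup>2 + \<bar>V y\<bar>\<^sup>2\<close> after squaring. This is why \<open>(I - V)(I + V)\<^sup>-\<^sup>1\<close> is orthogonal.
\<close>

lemma skew_shift_norm_eq:
  assumes "V \<in> skew_matrices"
  shows "norm ((mat 1 - V) *v y) = norm ((mat 1 + V) *v y)"
  unfolding norm_eq
  using skew_inner_self[OF assms, of y]
  by (simp add: matrix_vector_mult_add_rdistrib matrix_vector_mult_diff_rdistrib
      inner_add_right inner_add_left inner_diff_left inner_diff_right
      inner_commute[of "V *v y" y])

lemma skew_shift_det: "V \<in> skew_matrices \<Longrightarrow> det (mat 1 + V) \<noteq> 0"
  by (metis det_nonzero_iff_kernel inner_zero_right norm_eq_zero skew_shift_inner
      zero_eq_power2)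

text \<open>
  Every vector has the form \<open>(I + V) y\<close>, so this describes the transform completely and spares the
  inverse in calculations.
\<close>

lemma cayley_inv_apply:
  assumes "V \<in> skew_matrices"
  shows "cayley_inv S V *v ((mat 1 + V) *v y) = S *v ((mat 1 - V) *v y)"
  using matrix_inv_cancel(2)[OF skew_shift_det[OF assms]]
  by (simp add: cayley_inv_def matrix_vector_mul_assoc[symmetric])

text \<open>
  On \<open>(I + V) y\<close> the matrix \<open>I + S\<^sup>T \<phi>\<^sub>S\<^sup>-\<^sup>1(V)\<close> takes the value \<open>(I + V) y + (I - V) y = 2 y\<close>.
\<close>

lemma cayley_inv_regular:
  assumes S: "S \<in> orthogonal_group" and V: "V \<in> skew_matrices"
  shows "cayley_inv S V \<in> orthogonal_group - singular_orth S"
proof -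
  have surj: "\<exists>y. x = (mat 1 + V) *v y" for x
    using matrix_inv_cancel(1)[OF skew_shift_det[OF V]] by metis
  have "norm (cayley_inv S V *v x) = norm x" for x
    using surj[of x] by (auto simp: cayley_inv_apply V stiefel_norm S skew_shift_norm_eq)
  then have orth: "cayley_inv S V \<in> orthogonal_group"
    by (simp add: stiefel_iff_norm)
  have "x = 0" if x: "(mat 1 + transpose S ** cayley_inv S V) *v x = 0" for x
  proof -
    obtain y where y: "x = (mat 1 + V) *v y" using surj by blast
    have "(mat 1 + V) *v y + (mat 1 - V) *v y = 0"
      using x by (simp add: y matrix_vector_mult_add_rdistrib[of "mat 1" "transpose S ** _"]
          matrix_vector_mul_assoc[symmetric] cayley_inv_apply V stiefel_cancel[OF S])
    then have "y + y = 0"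
      by (simp add: matrix_vector_mult_add_rdistrib matrix_vector_mult_diff_rdistrib)
    then have "y = 0" by (simp add: flip: scaleR_2)
    then show ?thesis by (simp add: y)
  qed
  then show ?thesis
    using orth det_nonzero_iff_kernel by (auto simp: singular_orth_def)
qed

text \<open>
  A leading block of an invertible matrix is usually not invertible. Here it is, because for
  orthogonal \<open>R\<close> the quadratic form of \<open>I + R\<close> at \<open>v\<close> is \<open>\<bar>v + R v\<bar>\<^sup>2 / 2\<close> and thus vanishes only on
  the kernel.
\<close>

lemma Xi_map_regular:
  fixes S :: "real ^ ('p::finite + 'm::finite) ^ ('p + 'm)"
  assumes S: "S \<in> orthogonal_group" and W: "W \<in> orthogonal_group - singular_orth S"
  shows "Xi_map W \<in> stiefel - singular_stiefel S"
proof -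
  let ?J = "I_left :: real ^ 'p ^ ('p + 'm)"
  define R where "R = transpose S ** W"
  have R: "R \<in> orthogonal_group"
    using W S by (simp add: R_def stiefel_mult orthogonal_transpose)
  have ker: "v = 0" if "v + R *v v = 0" for v
  proof -
    have "det (mat 1 + R) \<noteq> 0"
      using W by (simp add: singular_orth_def R_def)
    moreover have "(mat 1 + R) *v v = 0"
      using that by (simp add: matrix_vector_mult_add_rdistrib)
    ultimately show ?thesis
      using det_nonzero_iff_kernel by blast
  qed
  have "x = 0" if x: "(mat 1 + transpose (left_block S) ** Xi_map W) *v x = 0" for x
  proof -
    define v where "v = ?J *v x"
    have "transpose ?J *v (v + R *v v) = 0"
      using x by (simp add: v_def R_def left_block_eq[of S] Xi_map_def matrix_transpose_mul
        matrix_vector_mult_add_rdistrib matrix_vector_right_distrib stiefel_cancel[OF I_left_stiefel]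
        matrix_vector_mul_assoc[symmetric])
    then have "v \<bullet> (v + R *v v) = 0"
      by (metis inner_transpose_right inner_zero_right v_def)
    moreover have "(v + R *v v) \<bullet> (v + R *v v) = 2 * (v \<bullet> (v + R *v v))"
      by (simp add: inner_add_left inner_add_right stiefel_inner[OF R] inner_commute)
    ultimately have "v + R *v v = 0"
      using inner_eq_zero_iff[of "v + R *v v"] by linarith
    then have "v = 0" by (rule ker)
    then show "x = 0"
      by (metis I_left_stiefel norm_eq_zero stiefel_norm v_def)
  qed
  then have "det (mat 1 + transpose (left_block S) ** Xi_map W) \<noteq> 0"
    by (simp add: det_nonzero_iff_kernel)
  moreover have "Xi_map W \<in> stiefel"
    using W by (simp add: Xi_map_def stiefel_mult I_left_stiefel)
  ultimately show ?thesis
    by (simp add: singular_stiefel_def)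
qed

section \<open>Regular points are images of the generalized transform\<close>

lemma cayley_domain_iff:
  "V \<in> cayley_domain \<longleftrightarrow> V \<in> skew_matrices \<and> (\<forall>i j. V $ Inr i $ Inr j = 0)"
proof
  assume "V \<in> cayley_domain"
  then obtain A B where V: "V = block_matrix A (- transpose B) B 0" and A: "transpose A = - A"
    by (auto simp: cayley_domain_def)
  have A': "A $ b $ a = - (A $ a $ b)" for a b
    using arg_cong[OF A, of "\<lambda>M. M $ a $ b"] by (simp add: transpose_def)
  have sk: "transpose V $ i $ j = (- V) $ i $ j" for i j
  proof (cases i)
    case (Inl a)
    then show ?thesis
      by (cases j) (simp_all add: V block_matrix_def transpose_def, rule A')
  next
    case (Inr a)
    then show ?thesis
      by (cases j) (simp_all add: V block_matrix_def transpose_def)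
  qed
  have "transpose V = - V"
    unfolding vec_eq_iff using sk by blast
  then show "V \<in> skew_matrices \<and> (\<forall>i j. V $ Inr i $ Inr j = 0)"
    by (simp add: skew_matrices_def V block_matrix_def)
next
  assume V: "V \<in> skew_matrices \<and> (\<forall>i j. V $ Inr i $ Inr j = 0)"
  have sk: "V $ j $ i = - (V $ i $ j)" for i j
  proof -
    have "transpose V $ i $ j = (- V) $ i $ j"
      using V by (simp only: skew_matrices_def mem_Collect_eq)
    then show ?thesis
      by (simp add: transpose_def)
  qed
  define A where "A = (\<chi> a b. V $ Inl a $ Inl b)"
  define B where "B = (\<chi> a b. V $ Inr a $ Inl b)"
  have "transpose A $ a $ b = (- A) $ a $ b" for a b
    using sk[of "Inl b" "Inl a"] by (simp add: A_def transpose_def)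
  then have A: "transpose A = - A"
    unfolding vec_eq_iff by blast
  have "V $ i $ j = block_matrix A (- transpose B) B 0 $ i $ j" for i j
  proof (cases i)
    case (Inl a)
    then show ?thesis
      by (cases j) (simp_all add: A_def B_def block_matrix_def transpose_def, rule sk)
  next
    case (Inr a)
    then show ?thesis
      using V by (cases j) (simp_all add: A_def B_def block_matrix_def transpose_def)
  qed
  then have "V = block_matrix A (- transpose B) B 0"
    unfolding vec_eq_iff by blast
  with A show "V \<in> cayley_domain"
    unfolding cayley_domain_def by blast
qed

lemma cayley_domain_skew: "V \<in> cayley_domain \<Longrightarrow> V \<in> skew_matrices"
  by (simp add: cayley_domain_iff)

lemma gen_cayley_inv_eq: "gen_cayley_inv S = Xi_map \<circ> cayley_inv S"
  by (simp add: fun_eq_iff gen_cayley_inv_def Xi_map_def cayley_inv_def)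

text \<open>
  Let \<open>W = S\<^sup>T U\<close>. The equation \<open>(I - V)(I + V)\<^sup>-\<^sup>1 J = W\<close> is equivalent to \<open>V (W + J) = J - W\<close>.
  With \<open>X = J\<^sup>T W\<close> and \<open>F = W - J X\<close>, the upper and the lower part of \<open>W\<close>, and with
  \<open>G = (I + X)\<^sup>-\<^sup>1\<close>, the lower block of the equation forces \<open>B\<close> to be the lower part of \<open>- F G\<close>.
  The upper block then forces \<open>A = G\<^sup>T (X\<^sup>T - X) G\<close>, which is skew-symmetric. The matrix \<open>V\<close> of the
  proof is assembled from these blocks by means of \<open>J\<close>.
\<close>

lemma regular_imp_gen_cayley_inv:
  fixes S :: "real ^ ('p::finite + 'm::finite) ^ ('p + 'm)"
  assumes S: "S \<in> orthogonal_group" and U: "U \<in> stiefel - singular_stiefel S"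
  shows "\<exists>V \<in> cayley_domain. gen_cayley_inv S V = U"
proof -
  let ?J = "I_left :: real ^ 'p ^ ('p + 'm)"
  note J = stiefel_cancel[OF I_left_stiefel]
  define W where "W = transpose S ** U"
  define X where "X = transpose ?J ** W"
  define F where "F = W - ?J ** X"
  define H where "H = mat 1 + X"
  define G where "G = matrix_inv H"
  define V where "V = ?J ** (transpose G ** (transpose X - X) ** G) ** transpose ?J
     + ?J ** transpose G ** transpose F - F ** G ** transpose ?J"
  have W: "W \<in> stiefel"
    using U S by (simp add: W_def stiefel_mult orthogonal_transpose)
  have detH: "det H \<noteq> 0"
    using U by (simp add: singular_stiefel_def H_def X_def W_def left_block_eq[of S]
        matrix_transpose_mul matrix_mul_assoc)
  have GH: "G *v (H *v x) = x" for x
    using matrix_inv_cancel(2)[OF detH] by (simp add: G_def)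
  have GHt: "transpose G *v (transpose H *v x) = x" for x
  proof -
    have "z \<bullet> (transpose G *v (transpose H *v x)) = z \<bullet> x" for z
      using matrix_inv_cancel(1)[OF detH] by (simp add: G_def inner_transpose_right)
    then show ?thesis
      using vector_eq_ldot by blast
  qed
  have tr_diff: "transpose (P - Q) = transpose P - transpose Q" for P Q :: "real ^ 'a ^ 'b"
    by (simp add: transpose_def vec_eq_iff)
  have tr_add: "transpose (P + Q) = transpose P + transpose Q" for P Q :: "real ^ 'a ^ 'b"
    by (simp add: transpose_def vec_eq_iff)
  have Xv: "transpose ?J *v (W *v x) = X *v x" for x
    by (simp add: X_def matrix_vector_mul_assoc)
  have Xtv: "transpose W *v (?J *v x) = transpose X *v x" for x
    by (simp add: X_def matrix_vector_mul_assoc matrix_transpose_mul)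
  have Fv: "F *v x = W *v x - ?J *v (X *v x)" for x
    by (simp add: F_def matrix_vector_mult_diff_rdistrib matrix_vector_mul_assoc)
  have Ftv: "transpose F *v y = transpose W *v y - transpose X *v (transpose ?J *v y)" for y
    by (simp add: F_def tr_diff matrix_transpose_mul matrix_vector_mult_diff_rdistrib
        matrix_vector_mul_assoc)
  have Vv: "V *v w = ?J *v (transpose G *v ((transpose X - X) *v (G *v (transpose ?J *v w))))
      + ?J *v (transpose G *v (transpose F *v w)) - F *v (G *v (transpose ?J *v w))" for w
    by (simp add: V_def matrix_vector_mult_diff_rdistrib matrix_vector_mult_add_rdistrib
        matrix_vector_mul_assoc matrix_mul_assoc)
  \<comment> \<open>Uses \<open>W\<^sup>T W = I\<close> in the form \<open>F\<^sup>T (W + J) = I - X\<^sup>T X\<close>; then everything telescopes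
      into \<open>G\<^sup>T (I + X)\<^sup>T (I - X) = I - X\<close>.\<close>
  have V_on_M: "V *v (W *v x + ?J *v x) = ?J *v x - W *v x" for x
  proof -
    have 1: "transpose ?J *v (W *v x + ?J *v x) = H *v x"
      by (simp add: H_def matrix_vector_right_distrib Xv J matrix_vector_mult_add_rdistrib
          add.commute)
    have 2: "transpose F *v (W *v x + ?J *v x) = x - transpose X *v (X *v x)"
      by (simp add: Ftv matrix_vector_right_distrib Xv Xtv J stiefel_cancel[OF W])
    have 3: "(transpose X - X) *v x + (x - transpose X *v (X *v x))
        = transpose H *v (x - X *v x)"
      by (simp add: H_def tr_add matrix_vector_mult_add_rdistrib matrix_vector_mult_diff_rdistrib
         matrix_vector_mult_diff_distrib)
    have "V *v (W *v x + ?J *v x)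
        = ?J *v (transpose G *v ((transpose X - X) *v x + (x - transpose X *v (X *v x)))) - F *v x"
      unfolding Vv 1 2 GH by (simp add: matrix_vector_right_distrib)
    also have "\<dots> = ?J *v (x - X *v x) - (W *v x - ?J *v (X *v x))"
      unfolding 3 GHt Fv ..
    finally show ?thesis
      by (simp add: matrix_vector_mult_diff_distrib)
  qed
  have "transpose V = - V"
    unfolding V_def tr_diff tr_add matrix_transpose_mul transpose_transpose
    by (simp add: matrix_mul_assoc matrix_eq matrix_vector_mul_assoc[symmetric]
        matrix_vector_mult_diff_rdistrib matrix_vector_mult_add_rdistrib
        matrix_vector_mult_minus matrix_vector_mult_diff_distrib)
  moreover have "V $ Inr i $ Inr j = 0" for i j
  proof -
    have r: "(?J ** P) $ Inr i $ k = 0" for P :: "real ^ 'c ^ 'p" and k and i :: 'm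
      by (simp add: matrix_matrix_mult_def left_block_def mat_def)
    have c: "(P ** transpose ?J) $ k $ Inr i = 0" for P :: "real ^ 'p ^ 'c" and k and i :: 'm
      by (simp add: matrix_matrix_mult_def left_block_def mat_def transpose_def)
    show ?thesis
      unfolding V_def by (simp add: r c matrix_mul_assoc[symmetric, of ?J])
  qed
  ultimately have V: "V \<in> cayley_domain" "V \<in> skew_matrices"
    by (simp_all add: cayley_domain_iff skew_matrices_def)
  have "gen_cayley_inv S V *v x = U *v x" for x
  proof -
    define w where "w = W *v x + ?J *v x"
    have "2 *\<^sub>R (?J *v x) = (mat 1 + V) *v w"
      by (simp add: matrix_vector_mult_add_rdistrib w_def V_on_M scaleR_2)
    then have "2 *\<^sub>R (gen_cayley_inv S V *v x) = S *v ((mat 1 - V) *v w)"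
      by (metis (no_types) V(2) cayley_inv_apply comp_apply gen_cayley_inv_eq Xi_map_def
          matrix_vector_mul_assoc matrix_vector_mult_scaleR)
    also have "(mat 1 - V) *v w = 2 *\<^sub>R (W *v x)"
      by (simp add: matrix_vector_mult_diff_rdistrib w_def V_on_M scaleR_2)
    also have "S *v (2 *\<^sub>R (W *v x)) = 2 *\<^sub>R (U *v x)"
      by (simp add: matrix_vector_mult_scaleR W_def matrix_vector_mul_assoc[symmetric]
          orthogonal_cancel S)
    finally show ?thesis by simp
  qed
  then show ?thesis
    using V(1) by (auto simp: matrix_eq)
qed

section \<open>Density of the regular points\<close>

lemma stiefel_transpose_contraction:
  assumes "U \<in> stiefel"
  shows "norm (transpose U *v y) \<le> norm y"
proof -
  have "(norm (transpose U *v y))\<^sup>2 = y \<bullet> (U *v (transpose U *v y))"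
    by (simp add: power2_norm_eq_inner inner_transpose_left)
  also have "\<dots> \<le> norm y * norm (transpose U *v y)"
    using norm_cauchy_schwarz stiefel_norm[OF assms] by metis
  finally show ?thesis
    by (cases "norm (transpose U *v y) = 0") (auto simp: power2_eq_square)
qed

lemma continuous_on_det:
  fixes f :: "'a::topological_space \<Rightarrow> real ^ 'n ^ 'n"
  assumes "continuous_on A f"
  shows "continuous_on A (\<lambda>x. det (f x))"
  unfolding det_def by (intro continuous_intros assms)

lemma continuous_on_matrix_mult:
  fixes f :: "'a::topological_space \<Rightarrow> real ^ 'n ^ 'm" and g :: "'a \<Rightarrow> real ^ 'k ^ 'n"
  assumes "continuous_on A f" "continuous_on A g"
  shows "continuous_on A (\<lambda>x. f x ** g x)"
  unfolding matrix_matrix_mult_def by (intro continuous_intros assms)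

lemma continuous_on_matrix_vector_mult:
  fixes f :: "'a::topological_space \<Rightarrow> real ^ 'n ^ 'm" and g :: "'a \<Rightarrow> real ^ 'n"
  assumes "continuous_on A f" "continuous_on A g"
  shows "continuous_on A (\<lambda>x. f x *v g x)"
  unfolding matrix_vector_mult_def by (intro continuous_intros assms)

text \<open>The rotation by the angle \<open>t\<close> in the plane of the orthonormal vectors \<open>a\<close> and \<open>e\<close>.\<close>

definition plane_rotation :: "'a::real_inner \<Rightarrow> 'a \<Rightarrow> real \<Rightarrow> 'a \<Rightarrow> 'a" where
  "plane_rotation a e t v =
     v + (cos t - 1) *\<^sub>R ((a \<bullet> v) *\<^sub>R a + (e \<bullet> v) *\<^sub>R e)
       + sin t *\<^sub>R ((a \<bullet> v) *\<^sub>R e - (e \<bullet> v) *\<^sub>R a)"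

lemma linear_plane_rotation: "linear (plane_rotation a e t)"
  by (rule linearI) (simp_all add: plane_rotation_def inner_add_right algebra_simps)

lemma norm_plane_rotation:
  assumes a: "norm a = 1" and e: "norm e = 1" and ae: "a \<bullet> e = 0"
  shows "norm (plane_rotation a e t v) = norm v"
proof -
  have aa: "a \<bullet> a = 1" "e \<bullet> e = 1" "e \<bullet> a = 0"
    using a e ae by (simp_all add: norm_eq_1 inner_commute)
  define p q where "p = a \<bullet> v" and "q = e \<bullet> v"
  define c s where "c = cos t" and "s = sin t"
  define u where "u = ((c - 1) * p - s * q) *\<^sub>R a + ((c - 1) * q + s * p) *\<^sub>R e"
  have pl: "plane_rotation a e t v = v + u"
    by (simp add: plane_rotation_def u_def p_def q_def c_def s_def algebra_simps)
  have vu: "v \<bullet> u = ((c - 1) * p - s * q) * p + ((c - 1) * q + s * p) * q"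
    by (simp add: u_def inner_add_right inner_commute[of v] p_def q_def)
  have uu: "u \<bullet> u = ((c - 1) * p - s * q)\<^sup>2 + ((c - 1) * q + s * p)\<^sup>2"
    by (simp add: u_def inner_add_right inner_add_left aa ae power2_eq_square)
  have "2 * (v \<bullet> u) + u \<bullet> u = (p\<^sup>2 + q\<^sup>2) * (c\<^sup>2 + s\<^sup>2 - 1)"
    unfolding vu uu by (simp add: power2_eq_square algebra_simps)
  then have "2 * (v \<bullet> u) + u \<bullet> u = 0"
    by (simp add: c_def s_def)
  then show ?thesis
    by (simp add: pl norm_eq inner_add_left inner_add_right inner_commute)
qed

lemma tendsto_plane_rotation:
  "(\<lambda>n. plane_rotation a e (inverse (real (Suc n))) v) \<longlonglongrightarrow> v"
proof -
  have "((\<lambda>t. plane_rotation a e t v) \<longlongrightarrow> plane_rotation a e 0 v) (nhds 0)"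
    unfolding plane_rotation_def by (intro tendsto_intros) (auto intro!: filterlim_ident)
  then have "(\<lambda>n. plane_rotation a e (inverse (real (Suc n))) v) \<longlonglongrightarrow> plane_rotation a e 0 v"
    by (rule filterlim_compose) (rule LIMSEQ_inverse_real_of_nat)
  then show ?thesis
    by (simp add: plane_rotation_def)
qed

lemma matrix_tendstoI:
  fixes F :: "'a \<Rightarrow> real ^ 'n ^ 'm"
  assumes "\<And>x. ((\<lambda>t. F t *v x) \<longlongrightarrow> M *v x) net"
  shows "(F \<longlongrightarrow> M) net"
proof (intro vec_tendstoI)
  fix i j
  have "((\<lambda>t. (F t *v axis j 1) $ i) \<longlongrightarrow> (M *v axis j 1) $ i) net"
    by (intro tendsto_vec_nth assms)
  then show "((\<lambda>t. F t $ i $ j) \<longlongrightarrow> M $ i $ j) net"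
    by (simp add: matrix_vector_mult_basis column_def)
qed

lemma openin_regular_stiefel:
  "openin (top_of_set stiefel) (stiefel - singular_stiefel S)"
proof -
  have "open {U. det (mat 1 + transpose (left_block S) ** U) \<noteq> 0}"
    by (intro open_Collect_neq continuous_on_det continuous_on_add continuous_on_matrix_mult
        continuous_intros)
  moreover have "stiefel - singular_stiefel S
      = stiefel \<inter> {U. det (mat 1 + transpose (left_block S) ** U) \<noteq> 0}"
    by (auto simp: singular_stiefel_def)
  ultimately show ?thesis
    by auto
qed

text \<open>
  Induction on the dimension of the kernel of \<open>I + L\<^sup>T U\<close>. Let \<open>z\<close> be a unit vector in this kernel,
  \<open>a = L z\<close>, and \<open>e\<close> the image under \<open>S\<close> of one of the last \<open>N - p\<close> coordinate vectors. Rotating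
  \<open>U\<close> by \<open>t\<close> in the plane of \<open>a\<close> and \<open>e\<close> adds to \<open>I + L\<^sup>T U\<close> a rank-one matrix with range spanned by
  \<open>z\<close>. The range of \<open>I + L\<^sup>T U\<close> is orthogonal to \<open>z\<close>, so the two terms vanish separately on the new
  kernel. It follows that the new kernel consists of vectors of the old one that are orthogonal to \<open>z\<close>.
\<close>

lemma regular_stiefel_dense:
  fixes S :: "real ^ ('p::finite + 'm::finite) ^ ('p + 'm)"
  assumes S: "S \<in> orthogonal_group"
  shows "U \<in> stiefel \<Longrightarrow> U \<in> closure (stiefel - singular_stiefel S)"
proof (induction "dim {x. (mat 1 + transpose (left_block S) ** U) *v x = 0}"
    arbitrary: U rule: less_induct)
  case less
  let ?L = "left_block S"
  let ?K = "\<lambda>U. {x. (mat 1 + transpose ?L ** U) *v x = 0}"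
  have U: "U \<in> stiefel" by (rule less.prems)
  have L: "?L \<in> stiefel" by (rule left_block_stiefel[OF S])
  have Kv: "(mat 1 + transpose ?L ** W) *v x = x + transpose ?L *v (W *v x)" for W x
    by (simp add: matrix_vector_mult_add_rdistrib matrix_vector_mul_assoc)
  show ?case
  proof (cases "det (mat 1 + transpose ?L ** U) = 0")
    case False
    then show ?thesis
      using U closure_subset[of "stiefel - singular_stiefel S"] by (auto simp: singular_stiefel_def)
  next
    case True
    then obtain z0 where z0: "z0 \<in> ?K U" "z0 \<noteq> 0"
      using det_nonzero_iff_kernel by blast
    define z where "z = z0 /\<^sub>R norm z0"
    have z: "z \<in> ?K U" "norm z = 1"
      using z0 by (simp_all add: z_def matrix_vector_mult_scaleR)
    \<comment> \<open>Equality in Cauchy--Schwarz: \<open>U x\<close> and \<open>L x\<close> both have norm \<open>\<bar>x\<bar>\<close>, and their inner product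
        is \<open>- \<bar>x\<bar>\<^sup>2\<close>.\<close>
    have UK: "U *v x = - (?L *v x)" if "x \<in> ?K U" for x
    proof -
      have "transpose ?L *v (U *v x) = - x"
        using that by (simp add: Kv eq_neg_iff_add_eq_0 add.commute)
      then have "(U *v x) \<bullet> (?L *v x) = - (x \<bullet> x)"
        by (metis inner_commute inner_minus_left inner_transpose_left)
      then have "(U *v x + ?L *v x) \<bullet> (U *v x + ?L *v x) = 0"
        by (simp add: inner_add_left inner_add_right stiefel_inner U L
            inner_commute[of "?L *v x" "U *v x"])
      then show ?thesis
        by (simp add: eq_neg_iff_add_eq_0)
    qed
    define a where "a = ?L *v z"
    define e where "e = S *v axis (Inr undefined) 1"
    have Le: "transpose ?L *v e = 0"
    proof -
      have "transpose ?L *v e = transpose I_left *v (transpose S *v e)"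
        by (subst left_block_eq) (simp add: matrix_transpose_mul matrix_vector_mul_assoc)
      also have "\<dots> = 0"
        by (simp add: e_def stiefel_cancel[OF S] vec_eq_iff transpose_I_left_apply axis_def)
      finally show ?thesis .
    qed
    have La: "transpose ?L *v a = z"
      by (simp add: a_def stiefel_cancel L)
    have a1: "norm a = 1" and e1: "norm e = 1"
      using z by (simp_all add: a_def e_def stiefel_norm L S)
    have eL: "e \<bullet> (?L *v x) = 0" for x
      using inner_transpose_left[of ?L e x] by (simp add: Le)
    then have ae: "a \<bullet> e = 0"
      by (metis a_def inner_commute)
    have aU: "a \<bullet> (U *v x) = - (z \<bullet> x)" for x
    proof -
      have "a = - (U *v z)" using UK[OF z(1)] by (simp add: a_def)
      then show ?thesis by (simp add: stiefel_inner U)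
    qed
    define W where "W t = matrix (plane_rotation a e t) ** U" for t
    have Wv: "W t *v x = plane_rotation a e t (U *v x)" for t x
      by (simp add: W_def matrix_vector_mul_assoc[symmetric] matrix_works linear_plane_rotation
          linear_matrix_vector_mul_eq)
    have W: "W t \<in> stiefel" for t
      by (simp add: stiefel_iff_norm Wv norm_plane_rotation a1 e1 ae stiefel_norm[OF U])
    have KW: "x + transpose ?L *v (W t *v x) = (x + transpose ?L *v (U *v x))
        + ((1 - cos t) * (z \<bullet> x) - sin t * (e \<bullet> (U *v x))) *\<^sub>R z" for t x
      by (simp add: Wv plane_rotation_def matrix_vector_right_distrib matrix_vector_mult_scaleR
          matrix_vector_mult_diff_distrib La Le aU algebra_simps)
    \<comment> \<open>The range of \<open>I + L\<^sup>T U\<close> is orthogonal to \<open>z\<close>.\<close>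
    have zK: "z \<bullet> (x + transpose ?L *v (U *v x)) = 0" for x
      using aU[of x] by (simp add: inner_add_right inner_transpose_right a_def inner_commute)
    have "W t \<in> closure (stiefel - singular_stiefel S)" if t: "0 < t" "t \<le> 1" for t
    proof -
      have c: "cos t \<noteq> 1"
        using cos_monotone_0_pi[of 0 t] t pi_gt3 by simp
      have sub: "x \<in> ?K U \<and> z \<bullet> x = 0" if x: "x \<in> ?K (W t)" for x
      proof -
        define k where "k = (1 - cos t) * (z \<bullet> x) - sin t * (e \<bullet> (U *v x))"
        have s: "(x + transpose ?L *v (U *v x)) + k *\<^sub>R z = 0"
          using x by (simp add: Kv KW k_def)
        have "z \<bullet> ((x + transpose ?L *v (U *v x)) + k *\<^sub>R z) = k"
          using z(2) by (simp only: inner_add_right[of z "_ + _" "_ *\<^sub>R _"] zK) (simp add: norm_eq_1)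
        then have k: "k = 0" by (simp add: s)
        then have xK: "x \<in> ?K U" using s by (simp add: Kv)
        have "e \<bullet> (U *v x) = 0" using UK[OF xK] eL[of x] by simp
        then show ?thesis using k c xK by (simp add: k_def)
      qed
      have "z \<notin> ?K (W t)"
        using sub[of z] z(2) by (auto simp: norm_eq_1)
      with sub z(1) have "?K (W t) \<subset> ?K U"
        by blast
      moreover have "subspace (?K V)" for V
        by (simp add: subspace_def matrix_vector_right_distrib matrix_vector_mult_scaleR)
      ultimately have "dim (?K (W t)) < dim (?K U)"
        by (metis dim_psubset span_eq_iff)
      then show ?thesis
        using less.hyps W by blast
    qed
    then have mem: "W (inverse (real (Suc n))) \<in> closure (stiefel - singular_stiefel S)" for n
      by (simp add: field_simps)
    have "(\<lambda>n. W (inverse (real (Suc n)))) \<longlonglongrightarrow> U"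
      by (rule matrix_tendstoI) (simp only: Wv tendsto_plane_rotation)
    from closed_sequentially[OF closed_closure mem this] show ?thesis .
  qed
qed

lemma open_dense_regular_stiefel:
  assumes "S \<in> orthogonal_group"
  shows "open_dense_in stiefel (stiefel - singular_stiefel S)"
  using regular_stiefel_dense[OF assms]
  by (auto simp: open_dense_in_def openin_regular_stiefel closure_of_subtopology Int_absorb1)

lemma open_dense_in_Int:
  assumes "open_dense_in X A" "open_dense_in X B"
  shows "open_dense_in X (A \<inter> B)"
proof -
  have "A \<subseteq> top_of_set X closure_of B"
    using assms openin_subset unfolding open_dense_in_def by metis
  then show ?thesis
    using assms closure_of_openin_Int_superset unfolding open_dense_in_def by blast
qed

lemma open_dense_in_nonempty: "open_dense_in X A \<Longrightarrow> X \<noteq> {} \<Longrightarrow> A \<noteq> {}"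
  by (auto simp: open_dense_in_def)

section \<open>Determinants of bounded matrices\<close>

text \<open>
  For \<open>t < 1\<close> the matrix \<open>I + t X\<close> is invertible because \<open>t X\<close> strictly shortens nonzero vectors. So
  the determinant does not change its sign on the way from \<open>I\<close> to \<open>I + X\<close>.
\<close>

lemma contraction_det_pos:
  fixes X :: "real ^ 'n ^ 'n"
  assumes X: "\<And>x. norm (X *v x) \<le> norm x" and det: "det (mat 1 + X) \<noteq> 0"
  shows "det (mat 1 + X) > 0"
proof (rule ccontr)
  assume neg: "\<not> det (mat 1 + X) > 0"
  define f where "f t = det (mat 1 + t *\<^sub>R X)" for t
  have "continuous_on {0..1} f"
    unfolding f_def by (intro continuous_on_det continuous_intros)
  moreover have "f 1 \<le> 0" "0 \<le> f 0"
    using neg by (simp_all add: f_def)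
  ultimately obtain t where t: "0 \<le> t" "t \<le> 1" "f t = 0"
    using IVT2'[of f 1 0 0] by auto
  then have "t < 1"
    using det by (cases "t = 1") (auto simp: f_def)
  have "x = 0" if "(mat 1 + t *\<^sub>R X) *v x = 0" for x
  proof -
    have "x = - (t *\<^sub>R (X *v x))"
      using that by (simp add: matrix_vector_mult_add_rdistrib scaleR_matrix_vector_assoc
          eq_neg_iff_add_eq_0)
    then have "norm x = t * norm (X *v x)"
      using t by (metis abs_of_nonneg norm_minus_cancel norm_scaleR)
    also have "\<dots> \<le> t * norm x"
      using X t by (intro mult_left_mono) auto
    finally have "(1 - t) * norm x \<le> 0" by (simp add: algebra_simps)
    then show ?thesis
      using \<open>t < 1\<close> by (simp add: mult_le_0_iff)
  qed
  then show False
    using t(3) det_nonzero_iff_kernel unfolding f_def by blast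
qed

lemma norm_matrix_le:
  fixes M :: "real ^ 'n ^ 'm"
  assumes "\<And>x. norm (M *v x) \<le> R * norm x"
  shows "norm M \<le> real CARD('m) * (real CARD('n) * R)"
proof -
  have entry: "\<bar>M $ i $ j\<bar> \<le> R" for i j
  proof -
    have "\<bar>(M *v axis j 1) $ i\<bar> \<le> R"
      using component_le_norm_cart[of "M *v axis j 1" i] assms[of "axis j 1"] by simp
    then show ?thesis
      by (simp add: matrix_vector_mult_basis column_def)
  qed
  have row: "norm (M $ i) \<le> real CARD('n) * R" for i
    using norm_le_l1_cart[of "M $ i"] sum_bounded_above[of UNIV "\<lambda>j. \<bar>M $ i $ j\<bar>" R] entry
    by force
  have "norm M \<le> (\<Sum>i\<in>UNIV. norm (M $ i))"
    unfolding norm_vec_def[of M] by (rule L2_set_le_sum) simp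
  also have "\<dots> \<le> real CARD('m) * (real CARD('n) * R)"
    using sum_bounded_above[of UNIV "\<lambda>i. norm (M $ i)"] row by fastforce
  finally show ?thesis .
qed

lemma compact_bounded_matrices:
  "compact {M :: real ^ 'n ^ 'm. \<forall>x. norm (M *v x) \<le> R * norm x}"
proof -
  have "closed {M :: real ^ 'n ^ 'm. norm (M *v x) \<le> R * norm x}" for x
    by (intro closed_Collect_le continuous_intros continuous_on_matrix_vector_mult)
  then have "closed {M :: real ^ 'n ^ 'm. \<forall>x. norm (M *v x) \<le> R * norm x}"
    by (rule closed_Collect_all)
  moreover have "bounded {M :: real ^ 'n ^ 'm. \<forall>x. norm (M *v x) \<le> R * norm x}"
    unfolding bounded_iff using norm_matrix_le by blast
  ultimately show ?thesis
    by (simp add: compact_eq_bounded_closed)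
qed

text \<open>
  The bound \<open>c\<close> is the minimum of \<open>\<bar>M x\<bar>\<close> over a compact set of pairs of an invertible matrix \<open>M\<close> and
  a unit vector \<open>x\<close>, hence positive and independent of \<open>M\<close>.
\<close>

lemma det_bounded_below_imp_expanding:
  assumes "\<delta> > 0"
  obtains c where "c > 0"
    "\<And>(M :: real ^ 'n ^ 'n) x. (\<And>x. norm (M *v x) \<le> R * norm x) \<Longrightarrow> \<bar>det M\<bar> \<ge> \<delta>
       \<Longrightarrow> c * norm x \<le> norm (M *v x)"
proof -
  define A where "A = {M :: real ^ 'n ^ 'n. \<forall>x. norm (M *v x) \<le> R * norm x} \<inter> {M. \<delta> \<le> \<bar>det M\<bar>}"
  have "closed {M :: real ^ 'n ^ 'n. \<delta> \<le> \<bar>det M\<bar>}"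
    by (intro closed_Collect_le continuous_intros continuous_on_det)
  then have "compact A"
    unfolding A_def by (intro compact_Int_closed compact_bounded_matrices)
  then have comp: "compact (A \<times> sphere (0 :: real ^ 'n) 1)"
    by (intro compact_Times compact_sphere)
  have "\<exists>c > 0. \<forall>M \<in> A. \<forall>x \<in> sphere 0 1. c \<le> norm (M *v x)"
  proof (cases "A = {}")
    case True
    then show ?thesis by (intro exI[of _ 1]) auto
  next
    case False
    moreover have "axis undefined 1 \<in> sphere (0 :: real ^ 'n) 1" by simp
    ultimately have ne: "A \<times> sphere (0 :: real ^ 'n) 1 \<noteq> {}" by blast
    have "continuous_on (A \<times> sphere (0 :: real ^ 'n) 1) (\<lambda>q. norm (fst q *v snd q))"
      by (intro continuous_intros continuous_on_matrix_vector_mult)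
    from continuous_attains_inf[OF comp ne this] obtain M x where
      Mx: "M \<in> A" "norm x = 1"
        and min: "\<And>M' x'. M' \<in> A \<Longrightarrow> norm x' = 1 \<Longrightarrow> norm (M *v x) \<le> norm (M' *v x')"
      by fastforce
    have "det M \<noteq> 0" using Mx assms by (auto simp: A_def)
    then have "M *v x \<noteq> 0" using Mx(2) det_nonzero_iff_kernel[of M] by auto
    then show ?thesis
      using min by (intro exI[of _ "norm (M *v x)"]) auto
  qed
  then obtain c where c: "c > 0" "\<And>M x. M \<in> A \<Longrightarrow> norm x = 1 \<Longrightarrow> c \<le> norm (M *v x)"
    by auto
  have "c * norm x \<le> norm (M *v x)"
    if "\<And>x. norm (M *v x) \<le> R * norm x" "\<bar>det M\<bar> \<ge> \<delta>" for M and x :: "real ^ 'n"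
  proof (cases "x = 0")
    case False
    have "c \<le> norm (M *v (x /\<^sub>R norm x))"
      using that False by (intro c(2)) (auto simp: A_def)
    then show ?thesis
      using False by (simp add: matrix_vector_mult_scaleR field_simps)
  qed simp
  with c(1) show ?thesis by (rule that)
qed

text \<open>
  The matrices in question are invertible and form a compact set, on which \<open>\<bar>det M\<bar>\<close> has a positive
  minimum.
\<close>

lemma expanding_imp_det_bounded_below:
  assumes "c > 0"
  obtains \<delta> where "\<delta> > 0"
    "\<And>M :: real ^ 'n ^ 'n. (\<And>x. norm (M *v x) \<le> R * norm x) \<Longrightarrow>
       (\<And>x. c * norm x \<le> norm (M *v x)) \<Longrightarrow> \<delta> \<le> \<bar>det M\<bar>"
proof -
  define A where "A = {M :: real ^ 'n ^ 'n. \<forall>x. norm (M *v x) \<le> R * norm x}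
    \<inter> {M. \<forall>x. c * norm x \<le> norm (M *v x)}"
  have "closed {M :: real ^ 'n ^ 'n. c * norm x \<le> norm (M *v x)}" for x
    by (intro closed_Collect_le continuous_intros continuous_on_matrix_vector_mult)
  then have "compact A"
    unfolding A_def by (intro compact_Int_closed compact_bounded_matrices closed_Collect_all)
  have pos: "\<bar>det M\<bar> > 0" if M: "M \<in> A" for M
  proof -
    have "x = 0" if "M *v x = 0" for x
    proof -
      have "c * norm x \<le> norm (M *v x)" using M by (simp add: A_def)
      then show ?thesis using \<open>c > 0\<close> that by (simp add: mult_le_0_iff)
    qed
    then show ?thesis using det_nonzero_iff_kernel[of M] by auto
  qed
  have "\<exists>\<delta> > 0. \<forall>M \<in> A. \<delta> \<le> \<bar>det M\<bar>"
  proof (cases "A = {}")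
    case True
    then show ?thesis by (intro exI[of _ 1]) auto
  next
    case False
    have "continuous_on A (\<lambda>M. \<bar>det M\<bar>)"
      by (intro continuous_intros continuous_on_det)
    from continuous_attains_inf[OF \<open>compact A\<close> False this] show ?thesis
      using pos by blast
  qed
  then show ?thesis
    using that by (auto simp: A_def)
qed

section \<open>The determinant of the generalized transform\<close>

lemma regular_stiefel_det_pos:
  assumes "S \<in> orthogonal_group" "U \<in> stiefel - singular_stiefel S"
  shows "det (mat 1 + transpose (left_block S) ** U) > 0"
proof (rule contraction_det_pos)
  show "norm ((transpose (left_block S) ** U) *v x) \<le> norm x" for x
    using assms stiefel_transpose_contraction[OF left_block_stiefel[OF assms(1)], of "U *v x"]
    by (simp add: matrix_vector_mul_assoc[symmetric] stiefel_norm)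
  show "det (mat 1 + transpose (left_block S) ** U) \<noteq> 0"
    using assms by (simp add: singular_stiefel_def)
qed

lemma gen_cayley_inv_regular:
  assumes "S \<in> orthogonal_group" "V \<in> skew_matrices"
  shows "gen_cayley_inv S V \<in> stiefel - singular_stiefel S"
  using Xi_map_regular cayley_inv_regular assms by (auto simp: gen_cayley_inv_eq)

lemma cayley_det_pos:
  assumes "S \<in> orthogonal_group" "V \<in> skew_matrices"
  shows "cayley_det S V > 0"
  unfolding cayley_det_def by (intro regular_stiefel_det_pos gen_cayley_inv_regular assms)

text \<open>
  The matrix whose determinant is \<^const>\<open>cayley_det\<close>. For skew-symmetric \<open>V\<close> and orthogonal \<open>S\<close> it
  is twice the leading \<open>p \<times> p\<close> block of \<open>(I + V)\<^sup>-\<^sup>1\<close>.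
\<close>

definition cayley_block ::
  "real ^ ('p::finite + 'm::finite) ^ ('p + 'm) \<Rightarrow> real ^ ('p + 'm) ^ ('p + 'm) \<Rightarrow> real ^ 'p ^ 'p" where
  "cayley_block S V = mat 1 + transpose (left_block S) ** gen_cayley_inv S V"

lemma norm_cayley_block_le:
  assumes "S \<in> orthogonal_group" "V \<in> skew_matrices"
  shows "norm (cayley_block S V *v x) \<le> 2 * norm x"
proof -
  have "norm (cayley_block S V *v x)
      \<le> norm x + norm (transpose (left_block S) *v (gen_cayley_inv S V *v x))"
    by (simp add: cayley_block_def matrix_vector_mult_add_rdistrib matrix_vector_mul_assoc[symmetric]
        norm_triangle_ineq)
  also have "\<dots> \<le> norm x + norm (gen_cayley_inv S V *v x)"
    using stiefel_transpose_contraction left_block_stiefel assms(1) by (intro add_left_mono) blast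
  also have "\<dots> = 2 * norm x"
    using gen_cayley_inv_regular[OF assms] by (simp add: stiefel_norm)
  finally show ?thesis .
qed

text \<open>
  The vector \<open>y = (I + V)\<^sup>-\<^sup>1 J x\<close> relates \<open>H = cayley_block S V\<close> to \<open>V\<close>. The last equation is
  \<open>\<bar>y\<bar>\<^sup>2 = y \<bullet> (I + V) y\<close>, which holds for skew-symmetric \<open>V\<close>.
\<close>

lemma cayley_block_resolvent:
  fixes S :: "real ^ ('p::finite + 'm::finite) ^ ('p + 'm)"
  assumes S: "S \<in> orthogonal_group" and V: "V \<in> skew_matrices"
  obtains y where "(mat 1 + V) *v y = I_left *v x"
    and "cayley_block S V *v x = 2 *\<^sub>R (transpose I_left *v y)"
    and "(norm y)\<^sup>2 = (transpose I_left *v y) \<bullet> x"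
proof
  let ?J = "I_left :: real ^ 'p ^ ('p + 'm)"
  define y where "y = matrix_inv (mat 1 + V) *v (?J *v x)"
  show y: "(mat 1 + V) *v y = ?J *v x"
    unfolding y_def by (rule matrix_inv_cancel(1)[OF skew_shift_det[OF V]])
  have "gen_cayley_inv S V *v x = S *v ((mat 1 - V) *v y)"
    unfolding cayley_inv_apply[OF V, symmetric] y
    by (simp add: gen_cayley_inv_eq Xi_map_def matrix_vector_mul_assoc)
  then have "cayley_block S V *v x = x + transpose ?J *v ((mat 1 - V) *v y)"
    by (simp add: cayley_block_def matrix_vector_mult_add_rdistrib[of "mat 1"] left_block_eq[of S]
        matrix_transpose_mul matrix_vector_mul_assoc[symmetric] stiefel_cancel[OF S])
  also have "\<dots> = transpose ?J *v ((mat 1 + V) *v y + (mat 1 - V) *v y)"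
    by (simp add: matrix_vector_right_distrib y stiefel_cancel[OF I_left_stiefel])
  also have "(mat 1 + V) *v y + (mat 1 - V) *v y = 2 *\<^sub>R y"
    by (simp add: matrix_vector_mult_add_rdistrib matrix_vector_mult_diff_rdistrib scaleR_2)
  finally show "cayley_block S V *v x = 2 *\<^sub>R (transpose ?J *v y)"
    by (simp add: matrix_vector_mult_scaleR)
  show "(norm y)\<^sup>2 = (transpose ?J *v y) \<bullet> x"
    using skew_shift_inner[OF V, of y] by (simp add: y inner_transpose_left)
qed

text \<open>
  This is the vanishing of the lower right block of \<open>V\<close>: a vector supported on the last \<open>N - p\<close>
  coordinates is mapped to one supported on the first \<open>p\<close>.
\<close>

lemma cayley_domain_maps_bottom_to_top:
  fixes V :: "real ^ ('p::finite + 'm::finite) ^ ('p + 'm)"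
  assumes V: "V \<in> cayley_domain" and w: "transpose (I_left :: real ^ 'p ^ ('p + 'm)) *v w = 0"
  shows "I_left *v (transpose (I_left :: real ^ 'p ^ ('p + 'm)) *v (V *v w)) = V *v w"
proof -
  have Inl: "w $ Inl a = 0" for a
    using transpose_I_left_apply[of w a] w by simp
  have "V $ Inr b $ j * w $ j = 0" for b j
    using V Inl by (cases j) (simp_all add: cayley_domain_iff)
  then have Inr: "(V *v w) $ Inr b = 0" for b
    unfolding matrix_vector_mult_def by (simp only: vec_lambda_beta sum.neutral_const)
  have "(I_left *v (transpose (I_left :: real ^ 'p ^ ('p + 'm)) *v (V *v w))) $ i = (V *v w) $ i" for i
    by (cases i) (simp_all add: I_left_apply transpose_I_left_apply Inr)
  then show ?thesis
    unfolding vec_eq_iff by blast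
qed

text \<open>
  A lower bound on the determinant bounds \<open>H\<^sup>-\<^sup>1\<close>. So every \<open>r\<close> is the upper part of some
  \<open>y = (I + V)\<^sup>-\<^sup>1 J x\<close> with \<open>x\<close> and \<open>y\<close> of size \<open>O(\<bar>r\<bar>)\<close>. On such \<open>y\<close> the value \<open>V y = J x - y\<close> is
  under control. What is left is a vector \<open>w\<close> with zero upper part. Its image \<open>V w\<close> lies in the
  upper coordinates; it is tested against itself, by pairing \<open>w\<close> with \<open>(I + V) y = J x\<close> for the \<open>y\<close>
  that has \<open>V w\<close> as upper part. For all skew-symmetric \<open>V\<close> the claim fails if \<open>N - p \<ge> 2\<close>: the lower
  right block of a block diagonal \<open>V\<close> can grow while the leading block of \<open>(I + V)\<^sup>-\<^sup>1\<close> is unchanged.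
\<close>

lemma cayley_det_bounded_below_imp_bounded:
  fixes S :: "real ^ ('p::finite + 'm::finite) ^ ('p + 'm)"
  assumes S: "S \<in> orthogonal_group" and "\<delta> > 0"
  obtains C where "\<And>V. V \<in> cayley_domain \<Longrightarrow> \<delta> \<le> cayley_det S V \<Longrightarrow> spectral_norm V \<le> C"
proof -
  let ?J = "I_left :: real ^ 'p ^ ('p + 'm)"
  obtain c where c: "c > 0" and exp: "\<And>(M :: real ^ 'p ^ 'p) x.
      (\<And>x. norm (M *v x) \<le> 2 * norm x) \<Longrightarrow> \<bar>det M\<bar> \<ge> \<delta> \<Longrightarrow> c * norm x \<le> norm (M *v x)"
    using det_bounded_below_imp_expanding[OF \<open>\<delta> > 0\<close>, where R = 2] by metis
  define k where "k = 2 / c"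
  have k: "k > 0" using c by (simp add: k_def)
  show ?thesis
  proof (rule that)
    fix V :: "real ^ ('p + 'm) ^ ('p + 'm)"
    assume Q: "V \<in> cayley_domain" and \<delta>: "\<delta> \<le> cayley_det S V"
    have V: "V \<in> skew_matrices" using Q by (rule cayley_domain_skew)
    define H where "H = cayley_block S V"
    have det: "\<delta> \<le> det H"
      using \<delta> by (simp add: H_def cayley_block_def cayley_det_def)
    have expH: "c * norm x \<le> norm (H *v x)" for x
      using det norm_cayley_block_le[OF S V] by (intro exp) (auto simp: H_def)
    have lift: "\<exists>x y. (mat 1 + V) *v y = ?J *v x \<and> transpose ?J *v y = r
        \<and> norm x \<le> k * norm r \<and> norm y \<le> k * norm r" for r
    proof -
      have "det H \<noteq> 0" using det \<open>\<delta> > 0\<close> by simp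
      from matrix_inv_cancel(1)[OF this] obtain x where x: "H *v x = 2 *\<^sub>R r" by metis
      obtain y where y: "(mat 1 + V) *v y = ?J *v x" "H *v x = 2 *\<^sub>R (transpose ?J *v y)"
        and ny: "(norm y)\<^sup>2 = (transpose ?J *v y) \<bullet> x"
        using cayley_block_resolvent[OF S V] unfolding H_def by metis
      have r: "transpose ?J *v y = r" using y(2) x by simp
      have nx: "norm x \<le> k * norm r"
        using expH[of x] c by (simp add: x k_def field_simps)
      have "(norm y)\<^sup>2 \<le> norm (transpose ?J *v y) * norm x"
        unfolding ny by (rule norm_cauchy_schwarz)
      also have "\<dots> \<le> norm y * norm x"
        by (intro mult_right_mono stiefel_transpose_contraction I_left_stiefel norm_ge_zero)
      finally have "norm y \<le> norm x"
        by (cases "norm y = 0") (auto simp: power2_eq_square)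
      with nx r y(1) show ?thesis by force
    qed
    have bottom: "norm (V *v w) \<le> k * norm w" if w: "transpose ?J *v w = 0" for w
    proof -
      define q where "q = V *v w"
      define r where "r = transpose ?J *v q"
      have q: "?J *v r = q"
        unfolding r_def q_def by (rule cayley_domain_maps_bottom_to_top[OF Q w])
      \<comment> \<open>Since \<open>w\<close> and \<open>V (y - J r)\<close> are supported on complementary coordinates, pairing
          \<open>(I + V) y = J x\<close> with \<open>w\<close> gives \<open>w \<bullet> y = - w \<bullet> V q = \<bar>q\<bar>\<^sup>2\<close>.\<close>
      obtain x y where xy: "(mat 1 + V) *v y = ?J *v x" "transpose ?J *v y = r"
        "norm y \<le> k * norm r"
        using lift by blast
      have wJ: "w \<bullet> (?J *v u) = 0" for u
        using inner_transpose_left[of ?J w u] by (simp add: w)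
      have "transpose ?J *v (y - ?J *v r) = 0"
        by (simp add: matrix_vector_mult_diff_distrib xy(2) stiefel_cancel[OF I_left_stiefel])
      from cayley_domain_maps_bottom_to_top[OF Q this]
      have "w \<bullet> (V *v (y - ?J *v r)) = 0" by (metis wJ)
      then have "w \<bullet> (V *v y) = w \<bullet> (V *v q)"
        by (simp add: matrix_vector_mult_diff_distrib inner_diff_right q)
      moreover have "w \<bullet> y + w \<bullet> (V *v y) = 0"
        using arg_cong[OF xy(1), of "\<lambda>u. w \<bullet> u"]
        by (simp add: wJ matrix_vector_mult_add_rdistrib inner_add_right)
      ultimately have "w \<bullet> y = q \<bullet> q"
        using skew_inner[OF V, of w q] unfolding q_def[symmetric] by linarith
      then have "(norm q)\<^sup>2 \<le> norm w * norm y"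
        using norm_cauchy_schwarz[of w y] by (simp add: power2_norm_eq_inner)
      also have "\<dots> \<le> norm w * (k * norm q)"
      proof (intro mult_left_mono norm_ge_zero)
        have "norm q = norm r"
          by (simp add: q[symmetric] stiefel_norm[OF I_left_stiefel])
        then show "norm y \<le> k * norm q" using xy(3) by simp
      qed
      finally show ?thesis
        unfolding q_def[symmetric] using k
        by (cases "norm q = 0") (auto simp: power2_eq_square algebra_simps)
    qed
    \<comment> \<open>Split \<open>v = y + (v - y)\<close>, where \<open>y\<close> has the same upper part as \<open>v\<close>.\<close>
    have "norm (V *v v) \<le> norm v * (3 * k + k\<^sup>2)" for v
    proof -
      obtain x y where xy: "(mat 1 + V) *v y = ?J *v x" "transpose ?J *v y = transpose ?J *v v"
        "norm x \<le> k * norm (transpose ?J *v v)" "norm y \<le> k * norm (transpose ?J *v v)"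
        using lift by blast
      have le: "k * norm (transpose ?J *v v) \<le> k * norm v"
        using k by (intro mult_left_mono stiefel_transpose_contraction I_left_stiefel) auto
      have "V *v y = ?J *v x - y"
        using xy(1) by (simp add: matrix_vector_mult_add_rdistrib algebra_simps)
      then have 1: "norm (V *v y) \<le> 2 * (k * norm v)"
        using norm_triangle_ineq4[of "?J *v x" y] xy(3,4) le
        by (simp add: stiefel_norm[OF I_left_stiefel])
      have "norm (V *v (v - y)) \<le> k * norm (v - y)"
        by (intro bottom) (simp add: matrix_vector_mult_diff_distrib xy(2))
      also have "\<dots> \<le> k * (norm v + k * norm v)"
      proof (rule mult_left_mono)
        show "norm (v - y) \<le> norm v + k * norm v"
          using norm_triangle_ineq4[of v y] xy(4) le by linarith
      qed (use k in simp)
      finally have 2: "norm (V *v (v - y)) \<le> k * (norm v + k * norm v)" .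
      have "V *v v = V *v y + V *v (v - y)"
        by (simp add: matrix_vector_mult_diff_distrib)
      then have "norm (V *v v) \<le> norm (V *v y) + norm (V *v (v - y))"
        by (metis norm_triangle_ineq)
      with 1 2 show ?thesis
        by (simp add: power2_eq_square algebra_simps)
    qed
    then show "spectral_norm V \<le> 3 * k + k\<^sup>2"
      unfolding spectral_norm_def using k
      by (intro onorm_bound) (auto simp: mult.commute)
  qed
qed

text \<open>
  From \<open>\<bar>x\<bar> = \<bar>(I + V) y\<bar> \<le> (1 + C) \<bar>y\<bar>\<close> and \<open>2 \<bar>y\<bar>\<^sup>2 = H x \<bullet> x\<close> one gets
  \<open>\<bar>H x\<bar> \<ge> 2 \<bar>x\<bar> / (1 + C)\<^sup>2\<close>, which bounds the determinant from below.
\<close>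

lemma bounded_imp_cayley_det_bounded_below:
  fixes S :: "real ^ ('p::finite + 'm::finite) ^ ('p + 'm)"
  assumes S: "S \<in> orthogonal_group" and "C \<ge> 0"
  obtains \<delta> where "\<delta> > 0"
    "\<And>V. V \<in> skew_matrices \<Longrightarrow> spectral_norm V \<le> C \<Longrightarrow> \<delta> \<le> cayley_det S V"
proof -
  let ?J = "I_left :: real ^ 'p ^ ('p + 'm)"
  define c where "c = 2 / (1 + C)\<^sup>2"
  have c: "c > 0" using \<open>C \<ge> 0\<close> by (simp add: c_def)
  obtain \<delta> where \<delta>: "\<delta> > 0" "\<And>M :: real ^ 'p ^ 'p. (\<And>x. norm (M *v x) \<le> 2 * norm x) \<Longrightarrow>
       (\<And>x. c * norm x \<le> norm (M *v x)) \<Longrightarrow> \<delta> \<le> \<bar>det M\<bar>"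
    using expanding_imp_det_bounded_below[OF c, where R = 2] by metis
  show ?thesis
  proof (rule that)
    show "\<delta> > 0" by (rule \<delta>(1))
    fix V :: "real ^ ('p + 'm) ^ ('p + 'm)"
    assume V: "V \<in> skew_matrices" and C: "spectral_norm V \<le> C"
    have "c * norm x \<le> norm (cayley_block S V *v x)" for x
    proof -
      obtain y where y: "(mat 1 + V) *v y = ?J *v x"
        and H: "cayley_block S V *v x = 2 *\<^sub>R (transpose ?J *v y)"
        and ny: "(norm y)\<^sup>2 = (transpose ?J *v y) \<bullet> x"
        using cayley_block_resolvent[OF S V] by metis
      have "norm x = norm ((mat 1 + V) *v y)"
        by (simp add: y stiefel_norm[OF I_left_stiefel])
      also have "\<dots> \<le> norm y + norm (V *v y)"
        by (simp add: matrix_vector_mult_add_rdistrib norm_triangle_ineq)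
      also have "norm (V *v y) \<le> C * norm y"
        using onorm[OF matrix_vector_mul_bounded_linear, of V y] C
          mult_right_mono[OF C norm_ge_zero[of y]]
        by (simp add: spectral_norm_def)
      finally have "norm x \<le> (1 + C) * norm y" by (simp add: algebra_simps)
      then have "(norm x)\<^sup>2 \<le> (1 + C)\<^sup>2 * (norm y)\<^sup>2"
        by (metis norm_ge_zero power_mono power_mult_distrib)
      then have "c * (norm x)\<^sup>2 \<le> 2 * (norm y)\<^sup>2"
        using \<open>C \<ge> 0\<close> by (simp add: c_def field_simps)
      also have "\<dots> = (cayley_block S V *v x) \<bullet> x"
        by (simp add: ny H)
      also have "\<dots> \<le> norm (cayley_block S V *v x) * norm x"
        by (rule norm_cauchy_schwarz)
      finally show ?thesis
        by (cases "norm x = 0") (auto simp: power2_eq_square)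
    qed
    then have "\<delta> \<le> \<bar>det (cayley_block S V)\<bar>"
      using norm_cayley_block_le[OF S V] by (intro \<delta>(2))
    then show "\<delta> \<le> cayley_det S V"
      using cayley_det_pos[OF S V] by (simp add: cayley_block_def cayley_det_def)
  qed
qed

lemma cayley_det_tendsto_0:
  assumes S: "S \<in> orthogonal_group"
  shows "(cayley_det S \<longlongrightarrow> 0) (inf (filtercomap spectral_norm at_top) (principal cayley_domain))"
proof (rule tendstoI)
  fix \<delta> :: real
  assume "\<delta> > 0"
  then obtain C where C: "\<And>V. V \<in> cayley_domain \<Longrightarrow> \<delta> \<le> cayley_det S V \<Longrightarrow> spectral_norm V \<le> C"
    using cayley_det_bounded_below_imp_bounded[OF S] by blast
  have "dist (cayley_det S V) 0 < \<delta>" if "V \<in> cayley_domain" "C + 1 \<le> spectral_norm V" for V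
    using C[OF that(1)] that(2) cayley_det_pos[OF S cayley_domain_skew[OF that(1)]] by force
  then show "\<forall>\<^sub>F V in inf (filtercomap spectral_norm at_top) (principal cayley_domain).
      dist (cayley_det S V) 0 < \<delta>"
    unfolding eventually_inf_principal eventually_filtercomap_at_top_linorder by blast
qed

lemma spectral_norm_tendsto_infinity:
  assumes S: "S \<in> orthogonal_group" and V: "\<And>n. V n \<in> skew_matrices"
    and lim: "(\<lambda>n. cayley_det S (V n)) \<longlonglongrightarrow> 0"
  shows "filterlim (\<lambda>n. spectral_norm (V n)) at_top sequentially"
  unfolding filterlim_at_top
proof
  fix Z :: real
  obtain \<delta> where \<delta>: "\<delta> > 0"
    "\<And>V. V \<in> skew_matrices \<Longrightarrow> spectral_norm V \<le> max Z 0 \<Longrightarrow> \<delta> \<le> cayley_det S V"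
    using bounded_imp_cayley_det_bounded_below[OF S, of "max Z 0"] by auto
  have "\<forall>\<^sub>F n in sequentially. cayley_det S (V n) < \<delta>"
    using order_tendstoD(2)[OF lim \<delta>(1)] .
  then show "\<forall>\<^sub>F n in sequentially. Z \<le> spectral_norm (V n)"
  proof eventually_elim
    case (elim n)
    then show ?case using \<delta>(2)[OF V[of n]] by force
  qed
qed

section \<open>Images of the transforms and the theorem\<close>

text \<open>
  The inclusions from the regular points to the image of \<open>Q\<^bsub>N,p\<^esub>\<close>, to that of \<open>Q\<^bsub>N,N\<^esub>\<close>, to that of
  the regular orthogonal matrices and back to the regular points close a circle.
\<close>

lemma gen_cayley_inv_image:
  fixes S :: "real ^ ('p::finite + 'm::finite) ^ ('p + 'm)"
  assumes S: "S \<in> orthogonal_group"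
  shows "gen_cayley_inv S ` cayley_domain = stiefel - singular_stiefel S"
    and "gen_cayley_inv S ` skew_matrices = stiefel - singular_stiefel S"
    and "Xi_map ` (orthogonal_group - singular_orth S) = stiefel - singular_stiefel S"
proof -
  let ?R = "stiefel - singular_stiefel S"
  have 1: "?R \<subseteq> gen_cayley_inv S ` cayley_domain"
    using regular_imp_gen_cayley_inv[OF S] by fastforce
  have 2: "gen_cayley_inv S ` cayley_domain \<subseteq> gen_cayley_inv S ` skew_matrices"
    using cayley_domain_skew by blast
  have 3: "gen_cayley_inv S ` skew_matrices \<subseteq> Xi_map ` (orthogonal_group - singular_orth S)"
    unfolding gen_cayley_inv_eq using cayley_inv_regular[OF S] by auto
  have 4: "Xi_map ` (orthogonal_group - singular_orth S) \<subseteq> ?R"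
    using Xi_map_regular[OF S] by blast
  show "gen_cayley_inv S ` cayley_domain = ?R" "gen_cayley_inv S ` skew_matrices = ?R"
    "Xi_map ` (orthogonal_group - singular_orth S) = ?R"
    using 1 2 3 4 by blast+
qed

theorem theorem2p3:
  fixes S :: "real ^ ('p::finite + 'm::finite) ^ ('p + 'm)"
  assumes "S \<in> orthogonal_group"
  shows
    "(stiefel - singular_stiefel S = Xi_map ` (orthogonal_group - singular_orth S)
      \<and> gen_cayley_inv S ` cayley_domain = (Xi_map \<circ> cayley_inv S) ` cayley_domain
      \<and> (Xi_map \<circ> cayley_inv S) ` cayley_domain = (Xi_map \<circ> cayley_inv S) ` skew_matrices)
   \<and> open_dense_in stiefel (stiefel - singular_stiefel S)
   \<and> (\<forall>S1 \<in> orthogonal_group. \<forall>S2 \<in> orthogonal_group.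
        let \<Delta> = (stiefel - singular_stiefel (S1 :: real ^ ('p + 'm) ^ ('p + 'm)))
                 \<inter> (stiefel - singular_stiefel S2)
        in \<Delta> \<noteq> {} \<and> open_dense_in stiefel \<Delta>)
   \<and> ((\<forall>V \<in> cayley_domain. cayley_det S V > 0)
      \<and> (cayley_det S \<longlongrightarrow> 0)
          (inf (filtercomap spectral_norm at_top) (principal cayley_domain))
      \<and> (\<forall>V :: nat \<Rightarrow> real ^ ('p + 'm) ^ ('p + 'm).
           (\<forall>n. V n \<in> cayley_domain) \<longrightarrow> (\<lambda>n. cayley_det S (V n)) \<longlonglongrightarrow> 0
           \<longrightarrow> filterlim (\<lambda>n. spectral_norm (V n)) at_top sequentially))"
proof (intro conjI ballI allI impI)
  note S = assms
  show "stiefel - singular_stiefel S = Xi_map ` (orthogonal_group - singular_orth S)"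
    by (simp add: gen_cayley_inv_image[OF S])
  show "gen_cayley_inv S ` cayley_domain = (Xi_map \<circ> cayley_inv S) ` cayley_domain"
    by (simp add: gen_cayley_inv_eq)
  show "(Xi_map \<circ> cayley_inv S) ` cayley_domain = (Xi_map \<circ> cayley_inv S) ` skew_matrices"
    by (simp flip: gen_cayley_inv_eq add: gen_cayley_inv_image[OF S])
  show "open_dense_in stiefel (stiefel - singular_stiefel S)"
    by (rule open_dense_regular_stiefel[OF S])
  show "let \<Delta> = (stiefel - singular_stiefel (S1 :: real ^ ('p + 'm) ^ ('p + 'm)))
                 \<inter> (stiefel - singular_stiefel S2)
        in \<Delta> \<noteq> {} \<and> open_dense_in stiefel \<Delta>"
    if "S1 \<in> orthogonal_group" "S2 \<in> orthogonal_group" for S1 S2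
  proof -
    have "open_dense_in stiefel ((stiefel - singular_stiefel S1) \<inter> (stiefel - singular_stiefel S2))"
      by (intro open_dense_in_Int open_dense_regular_stiefel that)
    moreover have "(stiefel :: (real ^ 'p ^ ('p + 'm)) set) \<noteq> {}"
      using I_left_stiefel by blast
    ultimately show ?thesis
      unfolding Let_def using open_dense_in_nonempty by blast
  qed
  show "cayley_det S V > 0" if "V \<in> cayley_domain" for V
    by (rule cayley_det_pos[OF S cayley_domain_skew[OF that]])
  show "(cayley_det S \<longlongrightarrow> 0) (inf (filtercomap spectral_norm at_top) (principal cayley_domain))"
    by (rule cayley_det_tendsto_0[OF S])
  show "filterlim (\<lambda>n. spectral_norm (V n)) at_top sequentially"
    if "\<forall>n. V n \<in> cayley_domain" "(\<lambda>n. cayley_det S (V n)) \<longlonglongrightarrow> 0" for V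
    using that by (intro spectral_norm_tendsto_infinity[OF S]) (auto intro: cayley_domain_skew)
qed

end
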